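(* Let $L$ be a finite-dimensional Lie algebra over a field $F$ and let \[ 0 = A_0 < A_1 < \cdots < A_n = L, \qquad 0 = B_0 < B_1 < \cdots < B_n = L \] be chief series for $L$. Then there is a bijection between the chief factors $A_i/A_{i-1}$ of the first series and the chief factors $B_j/B_{j-1}$ of the second series such that corresponding factors are isomorphic as $L$-modules and such that the Frattini chief factors in the two series correspond to each other.
   Context: A chief series is a chain of ideals of $L$ in which each successive quotient $A_i/A_{i-1}$ is a chief factor, i.e. there is no ideal of $L$ strictly between $A_{i-1}$ and $A_i$. The Frattini ideal $\phi(L)$ is the largest ideal of $L$ contained in the intersection of all maximal subalgebras. A chief factor $A/B$ is a Frattini chief factor if $A/B \subseteq \phi(L/B)$. *)

theory Defs
  imports Complex_Main
begin

definition lie_algebra :: "('a::field \<Rightarrow> 'v::ab_group_add \<Rightarrow> 'v) \<Rightarrow> ('v \<Rightarrow> 'v \<Rightarrow> 'v) \<Rightarrow> bool" where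
  "lie_algebra scale br \<longleftrightarrow>
     vector_space scale \<and>
     (\<forall>x y z. br (x + y) z = br x z + br y z) \<and>
     (\<forall>x y z. br x (y + z) = br x y + br x z) \<and>
     (\<forall>c x y. br (scale c x) y = scale c (br x y)) \<and>
     (\<forall>c x y. br x (scale c y) = scale c (br x y)) \<and>
     (\<forall>x. br x x = 0) \<and>
     (\<forall>x y z. br x (br y z) + br y (br z x) + br z (br x y) = 0)"

definition finite_dim :: "('a::field \<Rightarrow> 'v::ab_group_add \<Rightarrow> 'v) \<Rightarrow> bool" where
  "finite_dim scale \<longleftrightarrow> (\<exists>S. finite S \<and> module.span scale S = UNIV)"

definition is_subalg ::
  "'b set \<Rightarrow> 'b \<Rightarrow> ('b \<Rightarrow> 'b \<Rightarrow> 'b) \<Rightarrow> ('a \<Rightarrow> 'b \<Rightarrow> 'b) \<Rightarrow> ('b \<Rightarrow> 'b \<Rightarrow> 'b) \<Rightarrow> 'b set \<Rightarrow> bool" where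
  "is_subalg C z add sc br S \<longleftrightarrow>
     S \<subseteq> C \<and> z \<in> S \<and> (\<forall>x\<in>S. \<forall>y\<in>S. add x y \<in> S) \<and>
     (\<forall>c. \<forall>x\<in>S. sc c x \<in> S) \<and> (\<forall>x\<in>S. \<forall>y\<in>S. br x y \<in> S)"

definition is_ideal ::
  "'b set \<Rightarrow> 'b \<Rightarrow> ('b \<Rightarrow> 'b \<Rightarrow> 'b) \<Rightarrow> ('a \<Rightarrow> 'b \<Rightarrow> 'b) \<Rightarrow> ('b \<Rightarrow> 'b \<Rightarrow> 'b) \<Rightarrow> 'b set \<Rightarrow> bool" where
  "is_ideal C z add sc br I \<longleftrightarrow> is_subalg C z add sc br I \<and> (\<forall>x\<in>C. \<forall>y\<in>I. br x y \<in> I)"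

definition is_max_subalg ::
  "'b set \<Rightarrow> 'b \<Rightarrow> ('b \<Rightarrow> 'b \<Rightarrow> 'b) \<Rightarrow> ('a \<Rightarrow> 'b \<Rightarrow> 'b) \<Rightarrow> ('b \<Rightarrow> 'b \<Rightarrow> 'b) \<Rightarrow> 'b set \<Rightarrow> bool" where
  "is_max_subalg C z add sc br M \<longleftrightarrow> is_subalg C z add sc br M \<and> M \<noteq> C \<and>
     (\<forall>S. is_subalg C z add sc br S \<and> M \<subseteq> S \<longrightarrow> S = M \<or> S = C)"

definition frattini ::
  "'b set \<Rightarrow> 'b \<Rightarrow> ('b \<Rightarrow> 'b \<Rightarrow> 'b) \<Rightarrow> ('a \<Rightarrow> 'b \<Rightarrow> 'b) \<Rightarrow> ('b \<Rightarrow> 'b \<Rightarrow> 'b) \<Rightarrow> 'b set" where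
  "frattini C z add sc br = (GREATEST I. is_ideal C z add sc br I \<and>
       I \<subseteq> \<Inter> {M. is_max_subalg C z add sc br M})"

definition coset :: "'v::ab_group_add set \<Rightarrow> 'v \<Rightarrow> 'v set" where
  "coset B x = {x + b | b. b \<in> B}"

definition quot :: "'v::ab_group_add set \<Rightarrow> 'v set \<Rightarrow> 'v set set" where
  "quot A B = coset B ` A"

definition qadd :: "'v::ab_group_add set \<Rightarrow> 'v set \<Rightarrow> 'v set" where
  "qadd X Y = {x + y | x y. x \<in> X \<and> y \<in> Y}"

definition qscale :: "('a \<Rightarrow> 'v::ab_group_add \<Rightarrow> 'v) \<Rightarrow> 'v set \<Rightarrow> 'a \<Rightarrow> 'v set \<Rightarrow> 'v set" where
  "qscale scale D c X = {scale c x + d | x d. x \<in> X \<and> d \<in> D}"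

definition qbr :: "('v \<Rightarrow> 'v \<Rightarrow> 'v) \<Rightarrow> 'v::ab_group_add set \<Rightarrow> 'v set \<Rightarrow> 'v set \<Rightarrow> 'v set" where
  "qbr br D X Y = {br x y + d | x y d. x \<in> X \<and> y \<in> Y \<and> d \<in> D}"

definition qact :: "('v \<Rightarrow> 'v \<Rightarrow> 'v) \<Rightarrow> 'v::ab_group_add set \<Rightarrow> 'v \<Rightarrow> 'v set \<Rightarrow> 'v set" where
  "qact br D l X = {br l x + d | x d. x \<in> X \<and> d \<in> D}"

definition ideal_of :: "('a::field \<Rightarrow> 'v::ab_group_add \<Rightarrow> 'v) \<Rightarrow> ('v \<Rightarrow> 'v \<Rightarrow> 'v) \<Rightarrow> 'v set \<Rightarrow> bool" where
  "ideal_of scale br I \<longleftrightarrow> is_ideal UNIV 0 (+) scale br I"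

definition chief_series ::
  "('a::field \<Rightarrow> 'v::ab_group_add \<Rightarrow> 'v) \<Rightarrow> ('v \<Rightarrow> 'v \<Rightarrow> 'v) \<Rightarrow> (nat \<Rightarrow> 'v set) \<Rightarrow> nat \<Rightarrow> bool" where
  "chief_series scale br A n \<longleftrightarrow>
     A 0 = {0} \<and> A n = UNIV \<and>
     (\<forall>i\<le>n. ideal_of scale br (A i)) \<and>
     (\<forall>i<n. A i \<subset> A (Suc i)) \<and>
     (\<forall>i<n. \<not> (\<exists>J. ideal_of scale br J \<and> A i \<subset> J \<and> J \<subset> A (Suc i)))"

definition Lmod_iso ::
  "('a::field \<Rightarrow> 'v::ab_group_add \<Rightarrow> 'v) \<Rightarrow> ('v \<Rightarrow> 'v \<Rightarrow> 'v) \<Rightarrow> 'v set \<Rightarrow> 'v set \<Rightarrow> 'v set \<Rightarrow> 'v set \<Rightarrow> bool" where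
  "Lmod_iso scale br A A' B B' \<longleftrightarrow>
     (\<exists>\<phi>. bij_betw \<phi> (quot A A') (quot B B') \<and>
        (\<forall>X\<in>quot A A'. \<forall>Y\<in>quot A A'. \<phi> (qadd X Y) = qadd (\<phi> X) (\<phi> Y)) \<and>
        (\<forall>c. \<forall>X\<in>quot A A'. \<phi> (qscale scale A' c X) = qscale scale B' c (\<phi> X)) \<and>
        (\<forall>l. \<forall>X\<in>quot A A'. \<phi> (qact br A' l X) = qact br B' l (\<phi> X)))"

definition frattini_factor ::
  "('a::field \<Rightarrow> 'v::ab_group_add \<Rightarrow> 'v) \<Rightarrow> ('v \<Rightarrow> 'v \<Rightarrow> 'v) \<Rightarrow> 'v set \<Rightarrow> 'v set \<Rightarrow> bool" where
  "frattini_factor scale br A B \<longleftrightarrow>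
     quot A B \<subseteq> frattini (quot UNIV B) B qadd (qscale scale B) (qbr br B)"

end

(*
  The proof of the Jordan-Hoelder theorem compares two chief factors X/C and Y/C at the bottom
  through X + Y.  Usually X/C corresponds to (X + Y)/Y and (X + Y)/X to Y/C.  This fails to match
  Frattini factors only if, say, X/C is complemented by a maximal subalgebra M while (X + Y)/Y is
  Frattini.  Then M complements Y/C as well.  A Frattini chief factor is abelian (Fitting
  decomposition and Engel's theorem), so D = M \<inter> (X + Y) is an ideal, and
  X/C, (X + Y)/D and Y/C are isomorphic.  Moreover (X + Y)/X is Frattini too, so that here one
  pairs X/C with Y/C and (X + Y)/X with (X + Y)/Y.
*)
theory Submission
  imports Defs "HOL-Library.Multiset"
begin

text \<open>The usual pairing can fail in one way only: a maximal subalgebra over Y also lies over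
  C, so X/C Frattini forces (X + Y)/Y Frattini. Abelianness of (X + Y)/Y enters through [X, X + Y]
  \<subseteq> C: it makes X normalise D, and M does so anyway. It holds over every field. For Z/Y
  Frattini and x in Z, the Fitting null component of ad x modulo Y supplements Z; if it were proper,
  a maximal subalgebra above it would contain Y, hence Z, hence everything. So each ad x is
  nilpotent modulo Y, and Engel gives a nonzero central element of Z/Y. (X + Y)/X is Frattini
  because a maximal subalgebra M' over X that misses X + Y would make (M \<inter> M') + Y a proper
  subalgebra. It contains Y, so a maximal subalgebra above it contains X + Y, yet M \<inter> M' and
  X + Y together span L. The induction never passes to quotient algebras: factors are pairs of
  ideals of L, and series start at an arbitrary ideal C.\<close>

section \<open>Matchings of multisets\<close>

lemma rel_mset_union:
  assumes "rel_mset P L M" "rel_mset P L' M'"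
  shows "rel_mset P (L + L') (M + M')"
  using assms unfolding rel_mset_def by (metis list_all2_appendI mset_append)

text \<open>A multiset matching is realised by two aligned lists. Multiplicities in
  \<open>mset_set\<close> are at most one, so both lists are distinct and equality of positions is a
  bijection.\<close>

lemma rel_mset_set_bij:
  assumes "rel_mset P (mset_set I) (mset_set J)" "finite I" "finite J"
  shows "\<exists>\<sigma>. bij_betw \<sigma> I J \<and> (\<forall>i\<in>I. P i (\<sigma> i))"
proof -
  obtain xs ys where xy: "mset xs = mset_set I" "mset ys = mset_set J" "list_all2 P xs ys"
    using assms(1) unfolding rel_mset_def by blast
  have sets: "set xs = I" "set ys = J"
    using xy assms by (metis finite_set_mset_mset_set set_mset_mset)+
  then have "mset xs = mset_set (set xs)" "mset ys = mset_set (set ys)" using xy by simp_all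
  then have d: "distinct xs" "distinct ys"
    by (metis distinct_count_atmost_1 count_mset_set finite_set)+
  have len: "length xs = length ys" using xy(3) by (rule list_all2_lengthD)
  let ?n = "length xs"
  have bij_xs: "bij_betw ((!) xs) {..<?n} I" and bij_ys: "bij_betw ((!) ys) {..<?n} J"
    using d sets len bij_betw_nth by metis+
  define \<sigma> where "\<sigma> = (!) ys \<circ> inv_into {..<?n} ((!) xs)"
  have "bij_betw \<sigma> I J"
    unfolding \<sigma>_def by (rule bij_betw_trans[OF bij_betw_inv_into[OF bij_xs] bij_ys])
  moreover have "P i (\<sigma> i)" if i: "i \<in> I" for i
  proof -
    define k where "k = inv_into {..<?n} ((!) xs) i"
    have k: "k < ?n" "xs ! k = i"
      using i bij_xs unfolding k_def bij_betw_def
      by (metis inv_into_into lessThan_iff, metis f_inv_into_f)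
    then have "P (xs ! k) (ys ! k)" using xy(3) unfolding list_all2_conv_all_nth by blast
    then show ?thesis unfolding k(2) by (simp add: \<sigma>_def k_def)
  qed
  ultimately show ?thesis by blast
qed

section \<open>Finite-dimensional Lie algebras, ideals and sums\<close>

locale fin_lie = finite_dimensional_vector_space scale Basis
  for scale :: "'a::field \<Rightarrow> 'v::ab_group_add \<Rightarrow> 'v" and Basis +
  fixes br :: "'v \<Rightarrow> 'v \<Rightarrow> 'v"
  assumes br_add_left: "br (x + y) z = br x z + br y z"
    and br_add_right: "br x (y + z) = br x y + br x z"
    and br_scale_left: "br (scale c x) y = scale c (br x y)"
    and br_scale_right: "br x (scale c y) = scale c (br x y)"
    and br_self: "br x x = 0"
    and jacobi: "br x (br y z) + br y (br z x) + br z (br x y) = 0"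
begin

abbreviation "subalg \<equiv> is_subalg UNIV 0 (+) scale br"
abbreviation "lideal \<equiv> ideal_of scale br"
abbreviation "maxsub \<equiv> is_max_subalg UNIV 0 (+) scale br"

lemma br_zero_right [simp]: "br x 0 = 0"
  using br_add_right[of x 0 0] by simp

lemma br_minus_right: "br y (- x) = - br y x"
  using br_add_right[of y x "- x"] by (simp add: minus_unique)

lemma br_diff_right: "br z (x - y) = br z x - br z y"
  using br_add_right[of z x "- y"] by (simp add: br_minus_right)

lemma br_swap: "br y x = - br x y"
proof -
  have "0 = br (x + y) (x + y)" by (simp only: br_self)
  also have "\<dots> = br x y + br y x"
    unfolding br_add_left br_add_right by (simp add: br_self)
  finally have "br x y + br y x = 0" by simp
  then show ?thesis by (metis minus_unique)
qed

text \<open>The Jacobi identity in Leibniz form, as all later inductions along \<open>br x\<close>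
  use it.\<close>

lemma br_derivation: "br x (br y z) = br (br x y) z + br y (br x z)"
proof -
  have "br x (br y z) = - br y (br z x) - br z (br x y)"
    using jacobi[of x y z] by (simp add: algebra_simps eq_neg_iff_add_eq_0)
  then show ?thesis
    using br_swap[of z x] br_swap[of z "br x y"] by (simp add: br_minus_right)
qed

lemma subalg_iff: "subalg S \<longleftrightarrow> subspace S \<and> (\<forall>x\<in>S. \<forall>y\<in>S. br x y \<in> S)"
  unfolding is_subalg_def subspace_def by auto

lemma lideal_iff: "lideal I \<longleftrightarrow> subspace I \<and> (\<forall>x. \<forall>y\<in>I. br x y \<in> I)"
  unfolding ideal_of_def is_ideal_def subalg_iff by auto

lemma lideal_subspace: "lideal I \<Longrightarrow> subspace I"
  by (simp add: lideal_iff)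

lemma lideal_br_right: "lideal I \<Longrightarrow> y \<in> I \<Longrightarrow> br x y \<in> I"
  by (simp add: lideal_iff)

lemma lideal_br_left: "lideal I \<Longrightarrow> y \<in> I \<Longrightarrow> br y x \<in> I"
  by (metis br_swap lideal_br_right lideal_subspace subspace_neg)

lemma lideal_subalg: "lideal I \<Longrightarrow> subalg I"
  by (simp add: lideal_iff subalg_iff)

lemma lideal_Int: "lideal I \<Longrightarrow> lideal J \<Longrightarrow> lideal (I \<inter> J)"
  by (simp add: lideal_iff subspace_inter)

lemma lideal_UNIV: "lideal UNIV"
  by (simp add: lideal_iff)

lemma maxsub_iff:
  "maxsub M \<longleftrightarrow> subalg M \<and> M \<noteq> UNIV \<and> (\<forall>S. subalg S \<and> M \<subseteq> S \<longrightarrow> S = M \<or> S = UNIV)"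
  by (simp add: is_max_subalg_def)

lemma mem_qadd: "z \<in> qadd X Y \<longleftrightarrow> (\<exists>x\<in>X. \<exists>y\<in>Y. z = x + y)"
  unfolding qadd_def by auto

lemma qadd_commute: "qadd X Y = qadd Y (X :: 'v set)"
  unfolding qadd_def by (auto; metis add.commute)

lemma qadd_upper1: "subspace Y \<Longrightarrow> X \<subseteq> qadd X Y"
  by (force simp: mem_qadd dest: subspace_0)

lemma qadd_upper2: "subspace X \<Longrightarrow> Y \<subseteq> qadd X Y"
  by (force simp: mem_qadd dest: subspace_0)

lemma qadd_least: "subspace Z \<Longrightarrow> X \<subseteq> Z \<Longrightarrow> Y \<subseteq> Z \<Longrightarrow> qadd X Y \<subseteq> Z"
  by (auto simp: mem_qadd intro!: subspace_add)

lemma subspace_qadd: "subspace X \<Longrightarrow> subspace Y \<Longrightarrow> subspace (qadd X Y)"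
  using subspace_sums[of X Y] by (simp add: qadd_def)

lemma subalg_qadd:
  assumes S: "subalg S" and I: "lideal I"
  shows "subalg (qadd S I)"
  unfolding subalg_iff
proof (intro conjI ballI)
  show "subspace (qadd S I)"
    using S I by (simp add: subalg_iff lideal_iff subspace_qadd)
  fix u v assume "u \<in> qadd S I" "v \<in> qadd S I"
  then obtain s i t j where *: "s \<in> S" "i \<in> I" "u = s + i" "t \<in> S" "j \<in> I" "v = t + j"
    by (auto simp: mem_qadd)
  then have "br u v = br s t + (br s j + (br i t + br i j))"
    by (simp add: br_add_left br_add_right add.assoc)
  moreover have "br s t \<in> S" using S * by (simp add: subalg_iff)
  moreover have "br s j + (br i t + br i j) \<in> I"
    using I * by (intro subspace_add lideal_subspace lideal_br_left[of I i] lideal_br_right[of I j])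
  ultimately show "br u v \<in> qadd S I" by (auto simp: mem_qadd)
qed

lemma lideal_qadd: "lideal I \<Longrightarrow> lideal J \<Longrightarrow> lideal (qadd I J)"
  unfolding lideal_iff by (auto simp: subspace_qadd mem_qadd br_add_right) blast

section \<open>Chain conditions and maximal subalgebras\<close>

text \<open>Nested subspaces of equal dimension coincide, so a member of largest dimension is
  maximal. One rule thus serves subalgebras, ideals and kernels of powers of
  \<open>br x\<close>.\<close>

lemma maximal_subspace:
  assumes "P S" and P: "\<And>T. P T \<Longrightarrow> subspace T"
  shows "\<exists>M. P M \<and> S \<subseteq> M \<and> (\<forall>T. P T \<longrightarrow> M \<subseteq> T \<longrightarrow> T = M)"
proof -
  have "\<exists>M. (P M \<and> S \<subseteq> M) \<and> (\<forall>T. P T \<and> S \<subseteq> T \<longrightarrow> dim T \<le> dim M)"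
    by (rule ex_has_greatest_nat[of _ S _ "Suc dimension"])
      (use assms(1) dim_subset_UNIV in \<open>auto simp: less_Suc_eq_le\<close>)
  then obtain M where M: "P M" "S \<subseteq> M" "\<And>T. P T \<Longrightarrow> S \<subseteq> T \<Longrightarrow> dim T \<le> dim M"
    by blast
  have "T = M" if "P T" "M \<subseteq> T" for T
    using subspace_dim_equal[of M T] M P that by (metis order_trans)
  with M show ?thesis by blast
qed

lemma minimal_subspace:
  assumes "P S" and P: "\<And>T. P T \<Longrightarrow> subspace T"
  shows "\<exists>M. P M \<and> M \<subseteq> S \<and> (\<forall>T. P T \<longrightarrow> T \<subseteq> M \<longrightarrow> T = M)"
proof -
  obtain M where M: "P M" "M \<subseteq> S" "\<And>T. P T \<Longrightarrow> T \<subseteq> S \<Longrightarrow> dim M \<le> dim T"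
    using assms(1) ex_has_least_nat[of "\<lambda>M. P M \<and> M \<subseteq> S" S dim] by blast
  have "T = M" if "P T" "T \<subseteq> M" for T
    using subspace_dim_equal[of T M] M P that by (metis order_trans)
  with M show ?thesis by blast
qed

lemma maxsub_exists:
  assumes "subalg S" "S \<noteq> UNIV"
  obtains M where "maxsub M" "S \<subseteq> M"
proof -
  have "\<exists>M. (subalg M \<and> M \<noteq> UNIV) \<and> S \<subseteq> M \<and>
      (\<forall>T. subalg T \<and> T \<noteq> UNIV \<longrightarrow> M \<subseteq> T \<longrightarrow> T = M)"
    by (rule maximal_subspace) (use assms in \<open>auto simp: subalg_iff\<close>)
  then obtain M where M: "subalg M \<and> M \<noteq> UNIV" "S \<subseteq> M"
    "\<And>T. subalg T \<and> T \<noteq> UNIV \<Longrightarrow> M \<subseteq> T \<Longrightarrow> T = M"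
    by auto
  have "maxsub M" unfolding maxsub_iff using M(1) M(3) by auto
  then show ?thesis using that M(2) by simp
qed

text \<open>The sum is a subalgebra properly above \<open>M\<close>. In this way a maximal
  subalgebra that misses an ideal supplements it.\<close>

lemma maxsub_qadd_ideal:
  assumes "maxsub M" "lideal I" "\<not> I \<subseteq> M"
  shows "qadd M I = UNIV"
proof -
  have s: "subspace M" "subspace I" using assms by (auto simp: maxsub_iff subalg_iff lideal_iff)
  have "subalg (qadd M I)" using assms by (simp add: maxsub_iff subalg_qadd)
  moreover have "M \<subseteq> qadd M I" "I \<subseteq> qadd M I"
    using s qadd_upper1 qadd_upper2 by auto
  ultimately show ?thesis using assms unfolding maxsub_iff by metis
qed

section \<open>Chief factors as covers in the lattice of ideals\<close>

definition cover :: "'v set \<Rightarrow> 'v set \<Rightarrow> bool" where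
  "cover C X \<longleftrightarrow> lideal C \<and> lideal X \<and> C \<subset> X \<and> \<not> (\<exists>J. lideal J \<and> C \<subset> J \<and> J \<subset> X)"

lemma cover_between: "cover C X \<Longrightarrow> lideal J \<Longrightarrow> C \<subseteq> J \<Longrightarrow> J \<subseteq> X \<Longrightarrow> J = C \<or> J = X"
  unfolding cover_def by blast

lemma cover_exists:
  assumes "lideal C" "C \<noteq> UNIV"
  obtains X where "cover C X"
proof -
  have "\<exists>M. (lideal M \<and> C \<subset> M) \<and> M \<subseteq> UNIV \<and>
      (\<forall>T. lideal T \<and> C \<subset> T \<longrightarrow> T \<subseteq> M \<longrightarrow> T = M)"
    by (rule minimal_subspace) (use assms lideal_UNIV in \<open>auto simp: lideal_iff\<close>)
  then obtain X where X: "lideal X \<and> C \<subset> X"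
    "\<And>T. lideal T \<and> C \<subset> T \<Longrightarrow> T \<subseteq> X \<Longrightarrow> T = X"
    by blast
  have "cover C X" unfolding cover_def using X assms by auto
  then show ?thesis by (rule that)
qed

lemma cover_Int:
  assumes "cover C X" "cover C Y" "X \<noteq> Y"
  shows "X \<inter> Y = C"
proof -
  have *: "lideal (X \<inter> Y)" "C \<subseteq> X \<inter> Y" using assms lideal_Int by (auto simp: cover_def)
  then have "X \<inter> Y = C \<or> X \<inter> Y = X" "X \<inter> Y = C \<or> X \<inter> Y = Y"
    using assms cover_between[of C X "X \<inter> Y"] cover_between[of C Y "X \<inter> Y"] by auto
  with assms show ?thesis by blast
qed

text \<open>Modular law: an ideal \<open>J\<close> between \<open>X\<close> and the sum is governed
  by \<open>J \<inter> Y\<close>, which lies between \<open>C\<close> and \<open>Y\<close> and is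
  therefore one of the two.\<close>

lemma cover_qadd:
  assumes XY: "cover C X" "cover C Y" "X \<noteq> Y"
  shows "cover X (qadd X Y)"
proof -
  have C: "X \<inter> Y = C" using cover_Int[OF XY] .
  have i: "lideal X" "lideal Y" "lideal C" using XY by (auto simp: cover_def)
  have up: "X \<subseteq> qadd X Y" "Y \<subseteq> qadd X Y"
    using i qadd_upper1 qadd_upper2 lideal_subspace by auto
  have "X \<noteq> qadd X Y"
    using up XY C unfolding cover_def by (metis inf.absorb2 psubset_eq)
  moreover have False if J: "lideal J" "X \<subset> J" "J \<subset> qadd X Y" for J
  proof -
    have "lideal (J \<inter> Y)" "C \<subseteq> J \<inter> Y" using i J C lideal_Int by auto
    then consider "J \<inter> Y = C" | "J \<inter> Y = Y" using cover_between[OF XY(2)] by blast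
    then show False
    proof cases
      case 1
      have "J \<subseteq> X"
      proof
        fix j assume j: "j \<in> J"
        then obtain x y where xy: "x \<in> X" "y \<in> Y" "j = x + y" using J by (force simp: mem_qadd)
        then have "y = j - x" by simp
        then have "y \<in> J" using j xy J(1,2) by (metis lideal_subspace psubsetD subspace_diff)
        then show "j \<in> X" using 1 xy C i lideal_subspace subspace_add by blast
      qed
      with J show False by blast
    next
      case 2
      then have "qadd X Y \<subseteq> J" using J lideal_subspace qadd_least by blast
      with J show False by blast
    qed
  qed
  ultimately show ?thesis
    unfolding cover_def using up(1) i(1) lideal_qadd[OF i(1,2)] by (intro conjI) auto
qed

subsection \<open>Quotients and the Frattini ideal\<close>

lemma mem_coset: "y \<in> coset C x \<longleftrightarrow> y - x \<in> (C :: 'v set)"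
  unfolding coset_def by (auto simp: algebra_simps intro!: exI[of _ "y - x"])

lemma coset_eq_iff:
  assumes "subspace C"
  shows "coset C x = coset C y \<longleftrightarrow> x - y \<in> C"
proof
  assume "coset C x = coset C y"
  moreover have "x \<in> coset C x" using assms by (simp add: mem_coset subspace_0)
  ultimately show "x - y \<in> C" by (simp add: mem_coset)
next
  assume d: "x - y \<in> C"
  show "coset C x = coset C y"
  proof (rule set_eqI)
    fix z
    have "z - x = (z - y) - (x - y)" "z - y = (z - x) + (x - y)" by simp_all
    then show "z \<in> coset C x \<longleftrightarrow> z \<in> coset C y"
      unfolding mem_coset using d assms by (metis subspace_add subspace_diff)
  qed
qed

lemma coset_in_quot_iff:
  assumes "subspace C" "subspace S" "C \<subseteq> S"
  shows "coset C x \<in> quot S C \<longleftrightarrow> x \<in> S"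
proof
  assume "coset C x \<in> quot S C"
  then obtain y where "y \<in> S" "x - y \<in> C" unfolding quot_def using coset_eq_iff[OF assms(1)] by auto
  then have "y + (x - y) \<in> S" using assms by (intro subspace_add) auto
  then show "x \<in> S" by simp
qed (simp add: quot_def)

lemma quot_subset_iff:
  assumes "subspace C" "subspace S" "C \<subseteq> S"
  shows "quot X C \<subseteq> quot S C \<longleftrightarrow> X \<subseteq> S"
  using coset_in_quot_iff[OF assms] unfolding quot_def[of X] by auto

lemma coset_absorb: "subspace C \<Longrightarrow> coset C x = C \<longleftrightarrow> x \<in> C"
  using coset_eq_iff[of C x 0] by (simp add: coset_def)

lemma qadd_coset:
  assumes "subspace C"
  shows "qadd (coset C x) (coset C y) = coset C (x + y)"
proof (intro set_eqI iffI)
  fix z assume "z \<in> qadd (coset C x) (coset C y)"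
  then obtain u v where "u - x \<in> C" "v - y \<in> C" "z = u + v" by (auto simp: mem_qadd mem_coset)
  moreover from this have "z - (x + y) = (u - x) + (v - y)" by simp
  ultimately show "z \<in> coset C (x + y)" using assms by (metis mem_coset subspace_add)
next
  fix z assume z: "z \<in> coset C (x + y)"
  have "x \<in> coset C x" using assms by (simp add: mem_coset subspace_0)
  moreover have "z - x \<in> coset C y" using z by (simp add: mem_coset diff_diff_eq)
  ultimately show "z \<in> qadd (coset C x) (coset C y)" by (force simp: mem_qadd)
qed

text \<open>The summand from \<open>C\<close> in \<open>qscale\<close> fills up the coset; for
  \<open>c = 0\<close> the products alone would give just \<open>{0}\<close>. The same device makes
  \<open>qact\<close> and \<open>qbr\<close> return full cosets.\<close>

lemma qscale_coset:
  assumes "subspace C"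
  shows "qscale scale C c (coset C x) = coset C (scale c x)"
proof (intro set_eqI iffI)
  fix z assume "z \<in> qscale scale C c (coset C x)"
  then obtain u d where *: "u - x \<in> C" "d \<in> C" "z = scale c u + d"
    by (auto simp: qscale_def mem_coset)
  moreover from this have "z - scale c x = scale c (u - x) + d"
    by (simp add: scale_right_diff_distrib)
  ultimately show "z \<in> coset C (scale c x)"
    using assms by (metis mem_coset subspace_add subspace_scale)
next
  fix z assume z: "z \<in> coset C (scale c x)"
  have "x \<in> coset C x" using assms by (simp add: mem_coset subspace_0)
  moreover have "z = scale c x + (z - scale c x)" by simp
  ultimately show "z \<in> qscale scale C c (coset C x)"
    using z unfolding qscale_def mem_coset by blast
qed

lemma qact_coset:
  assumes "lideal C"
  shows "qact br C l (coset C x) = coset C (br l x)"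
proof (intro set_eqI iffI)
  have s: "subspace C" using assms by (rule lideal_subspace)
  {
    fix z assume "z \<in> qact br C l (coset C x)"
    then obtain u d where *: "u - x \<in> C" "d \<in> C" "z = br l u + d"
      by (auto simp: qact_def mem_coset)
    moreover from this have "z - br l x = br l (u - x) + d"
      by (simp add: br_diff_right)
    ultimately show "z \<in> coset C (br l x)"
      using assms s by (metis mem_coset subspace_add lideal_br_right)
  next
    fix z assume z: "z \<in> coset C (br l x)"
    have "x \<in> coset C x" using s by (simp add: mem_coset subspace_0)
    moreover have "z = br l x + (z - br l x)" by simp
    ultimately show "z \<in> qact br C l (coset C x)"
      using z unfolding qact_def mem_coset by blast
  }
qed

lemma qbr_coset:
  assumes "lideal C"
  shows "qbr br C (coset C x) (coset C y) = coset C (br x y)"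
proof (intro set_eqI iffI)
  have s: "subspace C" using assms by (rule lideal_subspace)
  {
    fix z assume "z \<in> qbr br C (coset C x) (coset C y)"
    then obtain u v d where *: "u - x \<in> C" "v - y \<in> C" "d \<in> C" "z = br u v + d"
      by (auto simp: qbr_def mem_coset)
    have "br u v = br (u - x) v + (br x (v - y) + br x y)"
      using br_add_left[of "u - x" x v] by (simp add: br_diff_right)
    then have "z - br x y = br (u - x) v + (br x (v - y) + d)" using * by simp
    then show "z \<in> coset C (br x y)"
      using assms s * by (metis mem_coset subspace_add lideal_br_right lideal_br_left)
  next
    fix z assume z: "z \<in> coset C (br x y)"
    have "x \<in> coset C x" "y \<in> coset C y" using s by (simp_all add: mem_coset subspace_0)
    moreover have "z = br x y + (z - br x y)" by simp
    ultimately show "z \<in> qbr br C (coset C x) (coset C y)"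
      using z unfolding qbr_def mem_coset by blast
  }
qed

lemma quot_subalg_iff:
  assumes B: "lideal B" and S: "subspace S" "B \<subseteq> S"
  shows "is_subalg (quot UNIV B) B qadd (qscale scale B) (qbr br B) (quot S B) \<longleftrightarrow> subalg S"
proof -
  have s: "subspace B" using B by (rule lideal_subspace)
  note c = coset_in_quot_iff[OF s S]
  have "B \<in> quot S B"
    using c[of 0] S coset_absorb[OF s, of 0] by (simp add: subspace_0 s)
  moreover have "quot S B \<subseteq> quot UNIV B" by (auto simp: quot_def)
  moreover have "(\<forall>X\<in>quot S B. P X) \<longleftrightarrow> (\<forall>x\<in>S. P (coset B x))" for P
    by (simp add: quot_def)
  ultimately show ?thesis
    using S unfolding is_subalg_def subspace_def
    by (simp add: qadd_coset s qscale_coset qbr_coset B c)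
qed

lemma quot_ideal_iff:
  assumes B: "lideal B" and S: "subspace S" "B \<subseteq> S"
  shows "is_ideal (quot UNIV B) B qadd (qscale scale B) (qbr br B) (quot S B) \<longleftrightarrow> lideal S"
proof -
  have s: "subspace B" using B by (rule lideal_subspace)
  note c = coset_in_quot_iff[OF s S]
  have "(\<forall>X\<in>quot S B. P X) \<longleftrightarrow> (\<forall>x\<in>S. P (coset B x))" for P S
    by (simp add: quot_def)
  then show ?thesis
    unfolding is_ideal_def quot_subalg_iff[OF assms] subalg_iff lideal_iff
    using S by (auto simp add: qbr_coset B c)
qed

text \<open>The preimage under the projection does it. Together with \<open>quot_subalg_iff\<close>
  this is the correspondence theorem, which moves all statements about L/B back into L.\<close>

lemma quot_subalg_lift:
  assumes B: "lideal B"
    and T: "is_subalg (quot UNIV B) B qadd (qscale scale B) (qbr br B) T"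
  obtains S where "subalg S" "B \<subseteq> S" "T = quot S B"
proof -
  have s: "subspace B" using B by (rule lideal_subspace)
  let ?S = "{x. coset B x \<in> T}"
  have "T = quot ?S B" using T by (auto simp: is_subalg_def quot_def)
  moreover have "B \<subseteq> ?S" using T by (auto simp: is_subalg_def coset_absorb[OF s, THEN iffD2])
  moreover have "subalg ?S"
    using T s coset_absorb[OF s, of 0] unfolding is_subalg_def
    by (auto simp: qadd_coset[symmetric] qscale_coset[symmetric] qbr_coset[OF B, symmetric] subspace_0)
  ultimately show ?thesis using that by blast
qed

lemma quot_maxsub_iff:
  assumes B: "lideal B"
  shows "is_max_subalg (quot UNIV B) B qadd (qscale scale B) (qbr br B) T \<longleftrightarrow>
    (\<exists>M. maxsub M \<and> B \<subseteq> M \<and> T = quot M B)" (is "?L \<longleftrightarrow> ?R")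
proof -
  have s: "subspace B" using B by (rule lideal_subspace)
  have eq: "quot S B = quot S' B \<longleftrightarrow> S = S'"
    if "subspace S" "B \<subseteq> S" "subspace S'" "B \<subseteq> S'" for S S'
    using quot_subset_iff[OF s] that by (metis subset_antisym order_refl)
  have U: "subspace UNIV" "B \<subseteq> UNIV" by auto
  show ?thesis
  proof
    assume L: ?L
    then obtain M where M: "subalg M" "B \<subseteq> M" "T = quot M B"
      using quot_subalg_lift[OF B] unfolding is_max_subalg_def by blast
    have sM: "subspace M" using M by (simp add: subalg_iff)
    have "M \<noteq> UNIV" using L M unfolding is_max_subalg_def by blast
    moreover have "S = M \<or> S = UNIV" if S: "subalg S" "M \<subseteq> S" for S
    proof -
      have sS: "subspace S" "B \<subseteq> S" using S M by (auto simp: subalg_iff)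
      have "quot S B = T \<or> quot S B = quot UNIV B"
        using L S quot_subalg_iff[OF B sS] quot_subset_iff[OF s sS, of M] M
        unfolding is_max_subalg_def by blast
      then show ?thesis using M eq[OF sS sM] eq[OF sS U] by auto
    qed
    ultimately have "maxsub M" using M(1) maxsub_iff by auto
    then show ?R using M by auto
  next
    assume ?R
    then obtain M where M: "maxsub M" "B \<subseteq> M" "T = quot M B" by blast
    have sM: "subspace M" "subalg M" using M by (auto simp: maxsub_iff subalg_iff)
    show ?L unfolding is_max_subalg_def
    proof (intro conjI allI impI)
      show "is_subalg (quot UNIV B) B qadd (qscale scale B) (qbr br B) T"
        using quot_subalg_iff[OF B] M sM by simp
      show "T \<noteq> quot UNIV B" using M eq[OF sM(1) M(2) U] by (auto simp: maxsub_iff)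
      fix S assume S: "is_subalg (quot UNIV B) B qadd (qscale scale B) (qbr br B) S \<and> T \<subseteq> S"
      then obtain S' where S': "subalg S'" "B \<subseteq> S'" "S = quot S' B"
        using quot_subalg_lift[OF B] by blast
      then have "M \<subseteq> S'" using S M quot_subset_iff[OF s] by (simp add: subalg_iff)
      then show "S = T \<or> S = quot UNIV B" using S' M maxsub_iff by blast
    qed
  qed
qed

text \<open>The condition A/B \<subseteq> \<phi>(L/B) pulled back to L. For an ideal
  \<open>A\<close>, lying in every maximal subalgebra over \<open>B\<close> is enough, since \<phi>
  is the largest ideal doing so.\<close>

definition frat :: "'v set \<Rightarrow> 'v set \<Rightarrow> bool" where
  "frat A B \<longleftrightarrow> (\<forall>M. maxsub M \<longrightarrow> B \<subseteq> M \<longrightarrow> A \<subseteq> M)"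

text \<open>\<open>GREATEST\<close> carries information only once a greatest element is exhibited.
  Here it is the image of \<open>G\<close>, the union of all ideals that qualify; they are closed
  under sums, so the union is again an ideal.\<close>

lemma frattini_factor_iff:
  assumes B: "lideal B" and A: "lideal A" "B \<subseteq> A"
  shows "frattini_factor scale br A B \<longleftrightarrow> frat A B"
proof -
  have s: "subspace B" using B by (rule lideal_subspace)
  define N where "N I \<longleftrightarrow> lideal I \<and> B \<subseteq> I \<and> frat I B" for I
  define G where "G = \<Union> (Collect N)"
  have sM: "subspace M" if "maxsub M" for M using that by (simp add: maxsub_iff subalg_iff)
  have N_add: "N (qadd I J)" if "N I" "N J" for I J
    using that qadd_least[OF sM] qadd_upper1[of J I]
    by (auto simp: N_def frat_def lideal_qadd lideal_subspace)
  have NB: "N B" using B by (auto simp: N_def frat_def)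
  have G_add: "x + y \<in> G" if xy: "x \<in> G" "y \<in> G" for x y
  proof -
    obtain I J where "N I" "x \<in> I" "N J" "y \<in> J" using xy unfolding G_def by blast
    moreover from this have "x + y \<in> qadd I J" by (auto simp: mem_qadd)
    ultimately show ?thesis using N_add by (auto simp: G_def)
  qed
  have GI: "lideal G" unfolding lideal_iff subspace_def
  proof (intro conjI allI ballI)
    show "0 \<in> G" using NB s subspace_0 by (auto simp: G_def)
    show "x + y \<in> G" if "x \<in> G" "y \<in> G" for x y using G_add that .
    show "scale c x \<in> G" if "x \<in> G" for c x
      using that by (auto simp: G_def N_def lideal_iff subspace_scale)
    show "br x y \<in> G" if "y \<in> G" for x y
      using that by (auto simp: G_def N_def lideal_iff)
  qed
  have BG: "B \<subseteq> G" using NB by (auto simp: G_def)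
  have "frat G B" unfolding G_def N_def frat_def by blast
  let ?P = "\<lambda>I. is_ideal (quot UNIV B) B qadd (qscale scale B) (qbr br B) I \<and>
    I \<subseteq> \<Inter> {M. is_max_subalg (quot UNIV B) B qadd (qscale scale B) (qbr br B) M}"
  have P_iff: "?P (quot I B) \<longleftrightarrow> lideal I \<and> frat I B" if "subspace I" "B \<subseteq> I" for I
  proof -
    have "quot I B \<subseteq> \<Inter> {T. \<exists>M. maxsub M \<and> B \<subseteq> M \<and> T = quot M B} \<longleftrightarrow>
      (\<forall>M. maxsub M \<longrightarrow> B \<subseteq> M \<longrightarrow> quot I B \<subseteq> quot M B)" by blast
    also have "\<dots> \<longleftrightarrow> frat I B"
      unfolding frat_def using quot_subset_iff[OF s sM, of _ I] by simp
    finally show ?thesis by (simp only: quot_ideal_iff[OF B that] quot_maxsub_iff[OF B])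
  qed
  have "frattini (quot UNIV B) B qadd (qscale scale B) (qbr br B) = quot G B"
    unfolding frattini_def
  proof (rule Greatest_equality)
    show "?P (quot G B)" using P_iff[OF lideal_subspace[OF GI] BG] GI \<open>frat G B\<close> by blast
    fix T assume T: "?P T"
    then obtain I where I: "subalg I" "B \<subseteq> I" "T = quot I B"
      using quot_subalg_lift[OF B] unfolding is_ideal_def by blast
    then have "N I" using T P_iff[of I] by (simp add: N_def subalg_iff)
    then have "I \<subseteq> G" by (auto simp: G_def)
    then show "T \<le> quot G B" using I by (auto simp: quot_def)
  qed
  then have "frattini_factor scale br A B \<longleftrightarrow> A \<subseteq> G"
    unfolding frattini_factor_def
    using quot_subset_iff[OF s lideal_subspace[OF GI] BG] by simp
  also have "\<dots> \<longleftrightarrow> frat A B"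
    using A \<open>frat G B\<close> unfolding frat_def G_def N_def by blast
  finally show ?thesis .
qed

subsection \<open>Frattini chief factors are abelian\<close>

lemma funpow_br_add: "(br x ^^ n) (y + z) = (br x ^^ n) y + (br x ^^ n) z"
  by (induction n) (simp_all add: br_add_right)

lemma funpow_br_scale: "(br x ^^ n) (scale c y) = scale c ((br x ^^ n) y)"
  by (induction n) (simp_all add: br_scale_right)

lemma funpow_br_zero: "(br x ^^ n) 0 = 0"
  by (induction n) simp_all

lemma funpow_br_mem: "(\<And>y. y \<in> S \<Longrightarrow> br x y \<in> S) \<Longrightarrow> y \<in> S \<Longrightarrow> (br x ^^ n) y \<in> S"
  by (induction n) simp_all

lemma subspace_funpow_vimage: "subspace S \<Longrightarrow> subspace {y. (br x ^^ n) y \<in> S}"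
  unfolding subspace_def by (simp add: funpow_br_add funpow_br_scale funpow_br_zero)

lemma subspace_funpow_image: "subspace S \<Longrightarrow> subspace ((br x ^^ n) ` S)"
  unfolding subspace_def
  by (auto simp: funpow_br_add[symmetric] funpow_br_scale[symmetric]
      intro: image_eqI[of 0 _ 0] funpow_br_zero[symmetric])

text \<open>The Fitting null component of \<open>ad x\<close> modulo \<open>Y\<close>.\<close>

definition null_comp :: "'v set \<Rightarrow> 'v \<Rightarrow> 'v set" where
  "null_comp Y x = {y. \<exists>n. (br x ^^ n) y \<in> Y}"

lemma funpow_br_mono:
  assumes "lideal Y" "(br x ^^ n) y \<in> Y" "n \<le> m"
  shows "(br x ^^ m) y \<in> Y"
proof -
  have "(br x ^^ (m - n)) ((br x ^^ n) y) \<in> Y"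
    using assms funpow_br_mem[of Y x] lideal_br_right by blast
  then show ?thesis using assms(3) by (simp add: funpow_add[symmetric, THEN fun_cong, simplified])
qed

text \<open>Induction on \<open>p + q\<close> replaces the binomial Leibniz formula: one use of the
  derivation rule yields two terms, each with one exponent lowered. When an exponent is 0, an
  argument already lies in the ideal.\<close>

lemma funpow_br_br:
  assumes "lideal Y" "(br x ^^ p) y \<in> Y" "(br x ^^ q) z \<in> Y"
  shows "(br x ^^ (p + q)) (br y z) \<in> Y"
  using assms(2,3)
proof (induction "p + q" arbitrary: p q y z)
  case 0
  then show ?case using assms(1) lideal_br_right by simp
next
  case (Suc k)
  show ?case
  proof (cases "p = 0 \<or> q = 0")
    case True
    then have "br y z \<in> Y" using Suc.prems assms(1) lideal_br_right lideal_br_left by auto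
    then show ?thesis using funpow_br_mono[OF assms(1), of 0] by simp
  next
    case False
    then obtain p' q' where pq: "p = Suc p'" "q = Suc q'" by (metis not0_implies_Suc)
    have "(br x ^^ (p' + q)) (br (br x y) z) \<in> Y"
      using Suc.hyps(1)[of p' q "br x y" z] Suc.hyps(2) Suc.prems pq by (simp add: funpow_swap1)
    moreover have "(br x ^^ (p + q')) (br y (br x z)) \<in> Y"
      using Suc.hyps(1)[of p q' y "br x z"] Suc.hyps(2) Suc.prems pq by (simp add: funpow_swap1)
    moreover have "p + q' = k" "p' + q = k" using pq Suc.hyps(2) by auto
    ultimately have "(br x ^^ k) (br x (br y z)) \<in> Y"
      unfolding br_derivation[of x y z] funpow_br_add
      using assms(1) by (simp add: lideal_subspace subspace_add)
    then show ?thesis by (simp add: Suc.hyps(2)[symmetric] funpow_swap1)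
  qed
qed

lemma subalg_null_comp:
  assumes Y: "lideal Y"
  shows "subalg (null_comp Y x)"
  unfolding subalg_iff subspace_def
proof (intro conjI ballI allI)
  have s: "subspace Y" using Y by (rule lideal_subspace)
  show "0 \<in> null_comp Y x"
    using s subspace_0 by (auto simp: null_comp_def funpow_br_zero)
  show "scale c u \<in> null_comp Y x" if "u \<in> null_comp Y x" for c u
    using that s subspace_scale by (auto simp: null_comp_def funpow_br_scale)
  show "br u v \<in> null_comp Y x" if "u \<in> null_comp Y x" "v \<in> null_comp Y x" for u v
    using that funpow_br_br[OF Y] unfolding null_comp_def by blast
  show "u + v \<in> null_comp Y x" if uv: "u \<in> null_comp Y x" "v \<in> null_comp Y x" for u v
  proof -
    obtain p q where "(br x ^^ p) u \<in> Y" "(br x ^^ q) v \<in> Y" using uv by (auto simp: null_comp_def)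
    then have "(br x ^^ max p q) u \<in> Y" "(br x ^^ max p q) v \<in> Y"
      using funpow_br_mono[OF Y] by (meson max.cobounded1 max.cobounded2)+
    then have "(br x ^^ max p q) (u + v) \<in> Y" using s by (simp add: funpow_br_add subspace_add)
    then show ?thesis by (auto simp: null_comp_def)
  qed
qed

text \<open>The ranges of the powers of \<open>ad x\<close> stabilise, and they lie in \<open>Z\<close> from the first power on.\<close>

lemma fitting_decomposition:
  assumes Y: "lideal Y" and Z: "lideal Z" "x \<in> Z"
  shows "qadd (null_comp Y x) Z = UNIV"
proof -
  let ?f = "\<lambda>n. (br x ^^ n)"
  have "\<exists>S. (\<exists>n. S = range (?f n)) \<and> S \<subseteq> range (?f 1) \<and>
      (\<forall>T. (\<exists>n. T = range (?f n)) \<longrightarrow> T \<subseteq> S \<longrightarrow> T = S)"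
    by (rule minimal_subspace) (auto simp only: subspace_funpow_image subspace_UNIV)
  then obtain n where n: "range (?f n) \<subseteq> range (?f 1)"
    "\<And>m. range (?f m) \<subseteq> range (?f n) \<Longrightarrow> range (?f m) = range (?f n)"
    by metis
  have "range (?f (n + n)) \<subseteq> range (?f n)" by (auto simp: funpow_add)
  then have "range (?f (n + n)) = range (?f n)" using n(2) by blast
  have "y \<in> qadd (null_comp Y x) Z" for y
  proof -
    \<comment> \<open>Fitting's splitting: \<open>y - ?f n z\<close> is killed by the n-th power,
      while \<open>?f n z\<close> lies in the range of \<open>br x\<close>, hence in
      \<open>Z\<close>.\<close>
    obtain z where z: "?f n y = ?f (n + n) z"
      using \<open>range (?f (n + n)) = range (?f n)\<close> by (metis rangeE rangeI)
    have "?f n y = ?f n (y - ?f n z) + ?f n (?f n z)"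
      using funpow_br_add[of n x "y - ?f n z" "?f n z"] by simp
    then have "?f n (y - ?f n z) = 0" using z by (simp add: funpow_add)
    then have "y - ?f n z \<in> null_comp Y x"
      using Y lideal_subspace subspace_0 unfolding null_comp_def
      by (metis (mono_tags, lifting) mem_Collect_eq)
    moreover have "?f n z \<in> Z"
    proof -
      obtain w where "?f n z = br x w" using n(1) by auto
      then show ?thesis using Z lideal_br_left by metis
    qed
    moreover have "y = (y - ?f n z) + ?f n z" by simp
    ultimately show ?thesis unfolding mem_qadd by blast
  qed
  then show ?thesis by blast
qed

text \<open>A proper null component would lie in a maximal subalgebra. That one contains
  \<open>Y\<close>, so by the Frattini property also \<open>Z\<close>, against the Fitting
  decomposition.\<close>

lemma frat_ad_nilpotent:
  assumes Y: "lideal Y" and Z: "lideal Z" and F: "frat Z Y" and x: "x \<in> Z"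
  obtains N where "\<And>y. (br x ^^ N) y \<in> Y"
proof -
  have "null_comp Y x = UNIV"
  proof (rule ccontr)
    assume "null_comp Y x \<noteq> UNIV"
    then obtain M where M: "maxsub M" "null_comp Y x \<subseteq> M"
      using maxsub_exists subalg_null_comp[OF Y] by metis
    have "Y \<subseteq> null_comp Y x" unfolding null_comp_def by (auto intro: exI[of _ 0])
    then have "Z \<subseteq> M" using F M unfolding frat_def by blast
    then have "UNIV \<subseteq> M"
      using fitting_decomposition[OF Y Z x] M qadd_least[of M "null_comp Y x" Z]
      by (auto simp: maxsub_iff subalg_iff)
    then show False using M by (auto simp: maxsub_iff)
  qed
  \<comment> \<open>So far the exponent depends on \<open>y\<close>; the increasing chain
    \<open>?K\<close> becomes stationary and gives a uniform one.\<close>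
  let ?K = "\<lambda>n. {y. (br x ^^ n) y \<in> Y}"
  have "\<exists>S. (\<exists>n. S = ?K n) \<and> ?K 0 \<subseteq> S \<and> (\<forall>T. (\<exists>n. T = ?K n) \<longrightarrow> S \<subseteq> T \<longrightarrow> T = S)"
    by (rule maximal_subspace) (auto simp only: subspace_funpow_vimage[OF lideal_subspace[OF Y]])
  then obtain N where N: "\<And>m. ?K N \<subseteq> ?K m \<Longrightarrow> ?K m = ?K N" by metis
  have "(br x ^^ N) y \<in> Y" for y
  proof -
    obtain n where n: "(br x ^^ n) y \<in> Y"
      using \<open>null_comp Y x = UNIV\<close> unfolding null_comp_def by blast
    have "?K N \<subseteq> ?K (max n N)" using funpow_br_mono[OF Y] by auto
    then have "?K (max n N) = ?K N" by (rule N)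
    moreover have "y \<in> ?K (max n N)" using funpow_br_mono[OF Y n] by simp
    ultimately show ?thesis by blast
  qed
  then show ?thesis by (rule that)
qed

section \<open>Engel's theorem modulo an ideal\<close>

text \<open>The analogue of the lower central series for \<open>K\<close> acting on all of L, with
  \<open>Y\<close> added to each term. Joint nilpotency of the action modulo \<open>Y\<close> means
  that some term lies in \<open>Y\<close>.\<close>

primrec act_series :: "'v set \<Rightarrow> 'v set \<Rightarrow> nat \<Rightarrow> 'v set" where
  "act_series Y K 0 = UNIV"
| "act_series Y K (Suc i) = span ({br k w | k w. k \<in> K \<and> w \<in> act_series Y K i} \<union> Y)"

lemma subspace_act_series: "subspace (act_series Y K i)"
  by (cases i) simp_all

lemma act_series_step: "k \<in> K \<Longrightarrow> w \<in> act_series Y K i \<Longrightarrow> br k w \<in> act_series Y K (Suc i)"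
  by (auto intro!: span_base)

lemma act_series_base: "Y \<subseteq> act_series Y K i"
  by (cases i) (auto intro: span_base)

lemma act_series_SucI:
  assumes "subspace T" "Y \<subseteq> T" "\<And>k w. k \<in> K \<Longrightarrow> w \<in> act_series Y K i \<Longrightarrow> br k w \<in> T"
  shows "act_series Y K (Suc i) \<subseteq> T"
  unfolding act_series.simps using assms by (intro span_minimal) auto

declare act_series.simps(2) [simp del]

lemma act_series_Suc_subset: "act_series Y K (Suc i) \<subseteq> act_series Y K i"
proof (induction i)
  case (Suc i)
  then show ?case by (intro act_series_SucI subspace_act_series act_series_base)
      (blast intro: act_series_step)
qed simp

text \<open>By the Leibniz rule [a, [k, w]] = [[a, k], w] + [k, [a, w]], and both summands again
  have a left factor in \<open>K\<close> and a right factor in the preceding term.\<close>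

lemma act_series_normalised:
  assumes Y: "lideal Y" and K: "\<And>k. k \<in> K \<Longrightarrow> br a k \<in> K"
  shows "w \<in> act_series Y K i \<Longrightarrow> br a w \<in> act_series Y K i"
proof (induction i arbitrary: w)
  case (Suc i)
  have "act_series Y K (Suc i) \<subseteq> {w. br a w \<in> act_series Y K (Suc i)}"
  proof (rule act_series_SucI)
    show "subspace {w. br a w \<in> act_series Y K (Suc i)}"
      using subspace_funpow_vimage[OF subspace_act_series, where n = 1 and x = a] by simp
    show "Y \<subseteq> {w. br a w \<in> act_series Y K (Suc i)}"
      using act_series_base[of Y K "Suc i"] lideal_br_right[OF Y] by blast
    fix k w assume "k \<in> K" "w \<in> act_series Y K i"
    then have "br (br a k) w + br k (br a w) \<in> act_series Y K (Suc i)"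
      by (intro subspace_add subspace_act_series act_series_step K Suc.IH)
    then show "br k w \<in> {w. br a w \<in> act_series Y K (Suc i)}"
      by (simp only: mem_Collect_eq br_derivation[of a k w])
  qed
  then show ?case using Suc.prems by blast
qed simp

text \<open>An element \<open>a\<close> that normalises \<open>K\<close> preserves every term of the series of \<open>K\<close>, so each of
  its steps is refined into \<open>N\<close> steps, along the kernels of the powers of \<open>ad a\<close>.\<close>

lemma engel_extend:
  assumes Y: "lideal Y" and K: "subspace K" "\<And>k. k \<in> K \<Longrightarrow> br a k \<in> K"
    and m: "act_series Y K m \<subseteq> Y" and N: "\<And>y. (br a ^^ N) y \<in> Y"
    and K': "\<And>k'. k' \<in> K' \<Longrightarrow> \<exists>k\<in>K. \<exists>c. k' = k + scale c a"
  shows "act_series Y K' (m * N) \<subseteq> Y"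
proof -
  note n = act_series_normalised[OF Y K(2)]
  \<comment> \<open>\<open>U i r\<close> interpolates between term \<open>Suc i\<close> (at
    \<open>r = 0\<close>) and term \<open>i\<close> (at \<open>r = N\<close>). Elements of
    \<open>K\<close> drop to term \<open>Suc i\<close> at once, and \<open>a\<close> lowers
    \<open>r\<close> by one, so \<open>N\<close> steps of the series of \<open>K'\<close> cover one
    step of that of \<open>K\<close>.\<close>
  define U where "U i r = act_series Y K i \<inter> {w. (br a ^^ r) w \<in> act_series Y K (Suc i)}" for i r
  have sU: "subspace (U i r)" for i r
    unfolding U_def by (intro subspace_inter subspace_act_series subspace_funpow_vimage)
  have UN: "U i N = act_series Y K i" for i
    unfolding U_def using N act_series_base[of Y K "Suc i"] by blast
  have U0: "U i 0 = act_series Y K (Suc i)" for i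
    unfolding U_def using act_series_Suc_subset[of Y K i] by auto
  have YU: "Y \<subseteq> U i r" for i r
    unfolding U_def using act_series_base[of Y K] funpow_br_mono[OF Y, of 0 a _ r] by fastforce
  have step: "br k' w \<in> U i r" if "k' \<in> K'" "w \<in> U i (Suc r)" for i r k' w
  proof -
    obtain k c where kc: "k \<in> K" "k' = k + scale c a" using K' \<open>k' \<in> K'\<close> by blast
    have w: "w \<in> act_series Y K i" "(br a ^^ r) (br a w) \<in> act_series Y K (Suc i)"
      using that by (auto simp: U_def funpow_swap1)
    have kw: "br k w \<in> act_series Y K (Suc i)" using kc w by (intro act_series_step)
    have "(br a ^^ r) (br k w) \<in> act_series Y K (Suc i)" by (rule funpow_br_mem[OF n kw])
    then have "br k w \<in> U i r" unfolding U_def using kw act_series_Suc_subset[of Y K i] by auto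
    moreover have "br a w \<in> U i r" unfolding U_def using w n by blast
    ultimately show ?thesis
      using sU by (simp add: kc br_add_left br_scale_left subspace_add subspace_scale)
  qed
  have inner: "act_series Y K' (n + j) \<subseteq> U i (N - j)"
    if "act_series Y K' n \<subseteq> act_series Y K i" "j \<le> N" for n i j
    using that(2)
  proof (induction j)
    case 0
    then show ?case using that(1) UN by simp
  next
    case (Suc j)
    then have "act_series Y K' (n + j) \<subseteq> U i (Suc (N - Suc j))" by (simp add: Suc_diff_Suc)
    then have "act_series Y K' (Suc (n + j)) \<subseteq> U i (N - Suc j)"
      by (intro act_series_SucI sU YU step) auto
    then show ?case by (simp only: add_Suc_right)
  qed
  have "act_series Y K' (i * N) \<subseteq> act_series Y K i" for i
  proof (induction i)
    case (Suc i)
    then show ?case using inner[OF Suc order_refl] U0 by (simp add: add.commute)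
  qed simp
  then show ?thesis using m by blast
qed

text \<open>A maximal subalgebra \<open>K\<close> of \<open>Z\<close> acting nilpotently modulo \<open>Y\<close> must be \<open>Z\<close>: otherwise the last term
  of its series meeting \<open>Z\<close> outside \<open>K\<close> yields a normalising element by which \<open>K\<close> can be enlarged.\<close>

lemma engel:
  assumes Y: "lideal Y" and Z: "lideal Z" "Y \<subseteq> Z"
    and nil: "\<And>x. x \<in> Z \<Longrightarrow> \<exists>N. \<forall>y. (br x ^^ N) y \<in> Y"
  shows "\<exists>m. act_series Y Z m \<subseteq> Y"
proof -
  let ?P = "\<lambda>K. subalg K \<and> K \<subseteq> Z \<and> Y \<subseteq> K \<and> (\<exists>m. act_series Y K m \<subseteq> Y)"
  have "act_series Y Y (Suc 0) \<subseteq> Y"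
    by (intro act_series_SucI lideal_subspace Y order_refl lideal_br_left)
  then have "?P Y" using Y Z lideal_subalg by blast
  then have "\<exists>K. ?P K \<and> Y \<subseteq> K \<and> (\<forall>T. ?P T \<longrightarrow> K \<subseteq> T \<longrightarrow> T = K)"
    by (rule maximal_subspace) (auto simp: subalg_iff)
  then obtain K where PK: "?P K" and K_max: "\<And>T. ?P T \<Longrightarrow> K \<subseteq> T \<Longrightarrow> T = K"
    by metis
  then obtain m where K: "subalg K" "K \<subseteq> Z" "Y \<subseteq> K" "act_series Y K m \<subseteq> Y" by blast
  have sK: "subspace K" using K by (simp add: subalg_iff)
  have "K = Z"
  proof (rule ccontr)
    assume "K \<noteq> Z"
    let ?Q = "\<lambda>i. act_series Y K i \<inter> Z \<subseteq> K"
    \<comment> \<open>Term 0 is all of L and term \<open>m\<close> lies in \<open>Y\<close>, so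
      \<open>?Q\<close> switches somewhere. For \<open>a\<close> taken just before the switch,
      \<open>br k a\<close> lies in the next term and in \<open>Z\<close>, hence in
      \<open>K\<close>.\<close>
    have "\<not> ?Q 0" "?Q m" using \<open>K \<noteq> Z\<close> K by auto
    then obtain i where i: "\<not> ?Q i" "?Q (Suc i)"
      using ex_least_nat_less[of ?Q m] by blast
    then obtain a where a: "a \<in> act_series Y K i" "a \<in> Z" "a \<notin> K" by blast
    have ka: "br k a \<in> K" if "k \<in> K" for k
      using i(2) act_series_step[OF that a(1)] lideal_br_right[OF Z(1) a(2)] by blast
    have ak: "br a k \<in> K" if "k \<in> K" for k
      using ka[OF that] br_swap[of a k] sK subspace_neg by simp
    obtain N where N: "\<And>y. (br a ^^ N) y \<in> Y" using nil[OF a(2)] by blast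
    define K' where "K' = {k + scale c a | k c. k \<in> K}"
    have KK': "K \<subseteq> K'" unfolding K'_def by (force intro: exI[of _ 0])
    have "a \<in> K'" unfolding K'_def using subspace_0[OF sK] by (force intro: exI[of _ 1])
    have "K' \<subseteq> Z"
      unfolding K'_def using K a Z by (auto intro!: subspace_add subspace_scale lideal_subspace)
    have "subspace K'"
    proof -
      have "K' = qadd K (span {a})" unfolding K'_def qadd_def span_singleton by blast
      then show ?thesis using sK by (simp add: subspace_qadd)
    qed
    moreover have "br u v \<in> K'" if uv: "u \<in> K'" "v \<in> K'" for u v
    proof -
      obtain k c l d where *: "k \<in> K" "u = k + scale c a" "l \<in> K" "v = l + scale d a"
        using uv unfolding K'_def by blast
      \<comment> \<open>The contribution of \<open>br a a\<close> vanishes, so such brackets even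
        fall back into \<open>K\<close>.\<close>
      have "br u v = br k l + (scale d (br k a) + scale c (br a l))"
        by (simp add: * br_add_left br_add_right br_scale_left br_scale_right br_self)
      also have "\<dots> \<in> K"
        using * K(1) by (intro subspace_add subspace_scale sK ka ak) (auto simp: subalg_iff)
      finally show ?thesis using KK' by blast
    qed
    ultimately have "subalg K'" by (simp add: subalg_iff)
    moreover have "act_series Y K' (m * N) \<subseteq> Y"
      by (rule engel_extend[OF Y sK ak K(4) N]) (auto simp: K'_def)
    ultimately have "?P K'" using \<open>K' \<subseteq> Z\<close> KK' K(3) by blast
    then have "K' = K" using K_max KK' by blast
    then show False using \<open>a \<in> K'\<close> a(3) by blast
  qed
  then show ?thesis using K by blast
qed

text \<open>Engel yields some \<open>w\<close> in \<open>Z\<close> outside \<open>Y\<close> that is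
  central in Z/Y. The preimage \<open>J\<close> of the centre of Z/Y is an ideal of L, so minimality
  of the chief factor makes it all of \<open>Z\<close>.\<close>

lemma frat_abelian:
  assumes YZ: "cover Y Z" and F: "frat Z Y" and x: "x \<in> Z" and y: "y \<in> Z"
  shows "br x y \<in> Y"
proof -
  have i: "lideal Y" "lideal Z" "Y \<subseteq> Z" "Y \<noteq> Z" using YZ by (auto simp: cover_def)
  have s: "subspace Y" "subspace Z" using i lideal_subspace by auto
  have "\<exists>m. act_series Y Z m \<subseteq> Y"
  proof (rule engel[OF i(1-3)])
    fix x assume "x \<in> Z"
    then obtain N where "\<And>y. (br x ^^ N) y \<in> Y" using frat_ad_nilpotent[OF i(1,2) F] by metis
    then show "\<exists>N. \<forall>y. (br x ^^ N) y \<in> Y" by blast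
  qed
  then obtain m where m: "act_series Y Z m \<subseteq> Y" by blast
  let ?Q = "\<lambda>i. act_series Y Z i \<inter> Z \<subseteq> Y"
  have "\<not> ?Q 0" "?Q m" using i m by auto
  then obtain j where j: "\<not> ?Q j" "?Q (Suc j)"
    using ex_least_nat_less[of ?Q m] by blast
  then obtain w where w: "w \<in> act_series Y Z j" "w \<in> Z" "w \<notin> Y" by blast
  define J where "J = {z\<in>Z. \<forall>u\<in>Z. br u z \<in> Y}"
  have "lideal J" unfolding lideal_iff subspace_def
  proof (intro conjI allI ballI)
    show "0 \<in> J" using s by (simp add: J_def subspace_0)
    show "u + v \<in> J" if "u \<in> J" "v \<in> J" for u v
      using that s by (simp add: J_def br_add_right subspace_add)
    show "scale c u \<in> J" if "u \<in> J" for c u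
      using that s by (simp add: J_def br_scale_right subspace_scale)
    show "br l z \<in> J" if z: "z \<in> J" for l z
    proof -
      have "br u (br l z) \<in> Y" if "u \<in> Z" for u
        unfolding br_derivation[of u l z]
      proof (rule subspace_add[OF s(1)])
        show "br (br u l) z \<in> Y" using z lideal_br_left[OF i(2) that] by (simp add: J_def)
        show "br l (br u z) \<in> Y" using z that lideal_br_right[OF i(1)] by (simp add: J_def)
      qed
      then show ?thesis using z lideal_br_right[OF i(2)] by (simp add: J_def)
    qed
  qed
  moreover have "Y \<subseteq> J" using i lideal_br_right by (auto simp: J_def)
  moreover have "J \<subseteq> Z" by (auto simp: J_def)
  moreover have "w \<in> J"
    unfolding J_def using w j(2) act_series_step[OF _ w(1)] lideal_br_right[OF i(2)] by blast
  ultimately have "J = Z" using cover_between[OF YZ] w by blast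
  then show ?thesis using x y unfolding J_def by blast
qed

subsection \<open>Isomorphisms of chief factors\<close>

lemma Lmod_iso_refl: "Lmod_iso scale br A A' A A'"
  unfolding Lmod_iso_def by (rule exI[of _ "\<lambda>X. X"]) (simp add: bij_betw_def)

lemma Lmod_iso_trans:
  assumes "Lmod_iso scale br A A' B B'" "Lmod_iso scale br B B' C C'"
  shows "Lmod_iso scale br A A' C C'"
proof -
  obtain f where f: "bij_betw f (quot A A') (quot B B')"
    "\<And>X Y. X \<in> quot A A' \<Longrightarrow> Y \<in> quot A A' \<Longrightarrow> f (qadd X Y) = qadd (f X) (f Y)"
    "\<And>c X. X \<in> quot A A' \<Longrightarrow> f (qscale scale A' c X) = qscale scale B' c (f X)"
    "\<And>l X. X \<in> quot A A' \<Longrightarrow> f (qact br A' l X) = qact br B' l (f X)"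
    using assms(1) unfolding Lmod_iso_def by metis
  obtain g where g: "bij_betw g (quot B B') (quot C C')"
    "\<And>X Y. X \<in> quot B B' \<Longrightarrow> Y \<in> quot B B' \<Longrightarrow> g (qadd X Y) = qadd (g X) (g Y)"
    "\<And>c X. X \<in> quot B B' \<Longrightarrow> g (qscale scale B' c X) = qscale scale C' c (g X)"
    "\<And>l X. X \<in> quot B B' \<Longrightarrow> g (qact br B' l X) = qact br C' l (g X)"
    using assms(2) unfolding Lmod_iso_def by metis
  have "f X \<in> quot B B'" if "X \<in> quot A A'" for X
    using f(1) that by (auto simp: bij_betw_def)
  then show ?thesis
    unfolding Lmod_iso_def
    by (intro exI[of _ "g \<circ> f"]) (simp add: bij_betw_trans[OF f(1) g(1)] f(2-4) g(2-4))
qed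

lemma quot_closed:
  assumes "lideal A" "lideal A'" "X \<in> quot A A'"
  shows "Y \<in> quot A A' \<Longrightarrow> qadd X Y \<in> quot A A'"
    and "qscale scale A' c X \<in> quot A A'"
    and "qact br A' l X \<in> quot A A'"
  using assms
  by (auto simp: quot_def qadd_coset qscale_coset qact_coset lideal_subspace
      intro!: imageI subspace_add subspace_scale lideal_br_right)

text \<open>The inverse cancels only on \<open>quot A A'\<close>, so this set has to be closed under
  the module operations; that is where \<open>A\<close> and \<open>A'\<close> being ideals
  enters.\<close>

lemma Lmod_iso_sym:
  assumes "lideal A" "lideal A'" "Lmod_iso scale br A A' B B'"
  shows "Lmod_iso scale br B B' A A'"
proof -
  obtain f where f: "bij_betw f (quot A A') (quot B B')"
    "\<And>X Y. X \<in> quot A A' \<Longrightarrow> Y \<in> quot A A' \<Longrightarrow> f (qadd X Y) = qadd (f X) (f Y)"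
    "\<And>c X. X \<in> quot A A' \<Longrightarrow> f (qscale scale A' c X) = qscale scale B' c (f X)"
    "\<And>l X. X \<in> quot A A' \<Longrightarrow> f (qact br A' l X) = qact br B' l (f X)"
    using assms(3) unfolding Lmod_iso_def by metis
  define g where "g = inv_into (quot A A') f"
  have gf: "g (f X) = X" if "X \<in> quot A A'" for X
    using f(1) that unfolding g_def bij_betw_def by (simp add: inv_into_f_f)
  have B: "quot B B' = f ` quot A A'" using f(1) by (simp add: bij_betw_def)
  note cl = quot_closed[OF assms(1,2)]
  have "g (qadd (f X) (f Y)) = qadd X Y" if "X \<in> quot A A'" "Y \<in> quot A A'" for X Y
    using f(2)[OF that] gf[OF cl(1)[OF that]] by simp
  moreover have "g (qscale scale B' c (f X)) = qscale scale A' c X" if "X \<in> quot A A'" for c X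
    using f(3)[OF that] gf[OF cl(2)[OF that]] by simp
  moreover have "g (qact br B' l (f X)) = qact br A' l X" if "X \<in> quot A A'" for l X
    using f(4)[OF that] gf[OF cl(3)[OF that]] by simp
  ultimately show ?thesis
    unfolding Lmod_iso_def B
    by (intro exI[of _ g]) (use bij_betw_inv_into[OF f(1)] in \<open>simp add: g_def[symmetric] gf B\<close>)
qed

lemma second_isomorphism:
  assumes X: "lideal X" and Y: "lideal Y"
  shows "Lmod_iso scale br Y (X \<inter> Y) (qadd X Y) X"
proof -
  have s: "subspace X" "subspace Y" "subspace (X \<inter> Y)" and C: "lideal (X \<inter> Y)"
    using assms lideal_subspace lideal_Int by auto
  \<comment> \<open>Adding \<open>X\<close> turns a coset of \<open>X \<inter> Y\<close> into the
    coset of \<open>X\<close> with the same representative, without any choice of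
    representatives.\<close>
  define f where "f Z = qadd Z X" for Z
  have f: "f (coset (X \<inter> Y) y) = coset X y" for y
  proof (intro set_eqI iffI)
    fix z assume "z \<in> f (coset (X \<inter> Y) y)"
    then obtain u x where "u - y \<in> X" "x \<in> X" "z = u + x" by (auto simp: f_def mem_qadd mem_coset)
    moreover from this have "z - y = (u - y) + x" by simp
    ultimately show "z \<in> coset X y" using s by (metis mem_coset subspace_add)
  next
    fix z assume z: "z \<in> coset X y"
    have "y \<in> coset (X \<inter> Y) y" using s by (simp add: mem_coset subspace_0)
    moreover have "z = y + (z - y)" by simp
    ultimately show "z \<in> f (coset (X \<inter> Y) y)"
      using z unfolding f_def mem_qadd mem_coset[of z X y] by (intro bexI)
  qed
  have "bij_betw f (quot Y (X \<inter> Y)) (quot (qadd X Y) X)"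
    unfolding bij_betw_def
  proof
    show "inj_on f (quot Y (X \<inter> Y))"
      using s by (auto simp: inj_on_def quot_def f coset_eq_iff subspace_diff)
    have "coset X ` Y \<subseteq> quot (qadd X Y) X"
      using qadd_upper2[OF s(1), of Y] by (auto simp: quot_def)
    moreover have "coset X (x + y) = coset X y" if "x \<in> X" for x y
      using that by (simp add: coset_eq_iff s)
    then have "quot (qadd X Y) X \<subseteq> coset X ` Y" by (auto simp: quot_def mem_qadd)
    ultimately have "quot (qadd X Y) X = coset X ` Y" by blast
    then show "f ` quot Y (X \<inter> Y) = quot (qadd X Y) X" by (simp add: quot_def image_image f)
  qed
  moreover have "(\<forall>Z\<in>quot Y (X \<inter> Y). P Z) \<longleftrightarrow> (\<forall>y\<in>Y. P (coset (X \<inter> Y) y))" for P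
    by (simp add: quot_def)
  ultimately show ?thesis
    unfolding Lmod_iso_def
    by (intro exI[of _ f]) (simp add: f qadd_coset qscale_coset qact_coset s C X)
qed

lemma Lmod_iso_diamond:
  assumes "lideal X" "lideal Y"
  shows "Lmod_iso scale br X (X \<inter> Y) (qadd X Y) Y"
  using second_isomorphism[OF assms(2,1)] by (simp add: qadd_commute Int_commute)

subsection \<open>The exchange argument\<close>

text \<open>\<open>M\<close> preserves \<open>Z \<inter> M\<close> as a subalgebra acting on an
  ideal, so only the supplement \<open>V\<close> needs a check. In every use, brackets of
  \<open>V\<close> with \<open>Z\<close> fall into \<open>C\<close>.\<close>

lemma lideal_Int_maxsub:
  assumes "maxsub M" "lideal Z" "qadd M V = UNIV"
    and br: "\<And>v z. v \<in> V \<Longrightarrow> z \<in> Z \<Longrightarrow> z \<in> M \<Longrightarrow> br v z \<in> M"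
  shows "lideal (Z \<inter> M)"
  unfolding lideal_iff
proof (intro conjI allI ballI)
  have s: "subspace M" "\<And>x y. x \<in> M \<Longrightarrow> y \<in> M \<Longrightarrow> br x y \<in> M"
    using assms(1) by (auto simp: maxsub_iff subalg_iff)
  show "subspace (Z \<inter> M)" using assms(2) s by (intro subspace_inter) (auto simp: lideal_iff)
  fix l z assume z: "z \<in> Z \<inter> M"
  obtain m v where mv: "m \<in> M" "v \<in> V" "l = m + v" using assms(3) mem_qadd[of l M V] by auto
  have "br l z = br m z + br v z" by (simp add: mv br_add_left)
  also have "\<dots> \<in> M" using z mv s br by (intro subspace_add) auto
  finally show "br l z \<in> Z \<inter> M" using z lideal_br_right[OF assms(2)] by blast
qed

lemma frat_mono:
  assumes "cover C X" "cover C Y" "frat X C"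
  shows "frat (qadd X Y) Y"
  unfolding frat_def
proof (intro allI impI)
  fix M assume M: "maxsub M" "Y \<subseteq> M"
  then have "C \<subseteq> M" using assms(2) by (auto simp: cover_def)
  then have "X \<subseteq> M" using M assms(3) by (simp add: frat_def)
  then show "qadd X Y \<subseteq> M" using M by (intro qadd_least) (auto simp: maxsub_iff subalg_iff)
qed

lemma frat_exchange:
  assumes XY: "cover C X" "cover C Y" "X \<noteq> Y"
    and nF: "\<not> frat X C" and F: "frat (qadd X Y) Y"
  shows "Lmod_iso scale br X C Y C \<and> \<not> frat Y C \<and> frat (qadd X Y) X"
proof -
  define S where "S = qadd X Y"
  have C: "X \<inter> Y = C" using cover_Int[OF XY] .
  have i: "lideal X" "lideal Y" "lideal C" "C \<subseteq> X" "C \<subseteq> Y" "C \<noteq> X" "C \<noteq> Y"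
    using XY by (auto simp: cover_def)
  have iS: "lideal S" using i lideal_qadd by (simp add: S_def)
  have s: "subspace X" "subspace Y" "subspace C" "subspace S" using i iS lideal_subspace by auto
  have XS: "X \<subseteq> S" and YS: "Y \<subseteq> S" using s qadd_upper1 qadd_upper2 by (auto simp: S_def)
  have YcS: "cover Y S" using cover_qadd[of C Y X] XY by (simp add: S_def qadd_commute)
  note subM = maxsub_iff subalg_iff
  obtain M where M: "maxsub M" "C \<subseteq> M" "\<not> X \<subseteq> M" using nF unfolding frat_def by blast
  have sM: "subspace M" using M by (simp add: subM)
  \<comment> \<open>Otherwise the Frattini property of S/Y would put \<open>S\<close>, and with it
    \<open>X\<close>, into \<open>M\<close>.\<close>
  have YM: "\<not> Y \<subseteq> M" using F M XS unfolding frat_def S_def by blast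
  have MX: "qadd M X = UNIV" and MY: "qadd M Y = UNIV"
    using maxsub_qadd_ideal M YM i by blast+
  have brXY: "br x y \<in> C" "br y x \<in> C" if "x \<in> X" "y \<in> Y" for x y
    using that C lideal_br_right[OF i(2)] lideal_br_left[OF i(1)]
      lideal_br_right[OF i(1)] lideal_br_left[OF i(2)] by blast+
  \<comment> \<open>Since S/Y is abelian the bracket lies in \<open>Y\<close>, and it lies in the
    ideal \<open>X\<close> as well.\<close>
  have brXS: "br x z \<in> C" if "x \<in> X" "z \<in> S" for x z
    using frat_abelian[OF YcS F[folded S_def]] that XS lideal_br_left[OF i(1)] C by blast
  have "lideal (X \<inter> M)"
    by (rule lideal_Int_maxsub[OF M(1) i(1) MY]) (use brXY M(2) in blast)
  then have XM: "X \<inter> M = C" using cover_between[OF XY(1)] i M by blast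
  have "lideal (Y \<inter> M)"
    by (rule lideal_Int_maxsub[OF M(1) i(2) MX]) (use brXY M(2) in blast)
  then have YM': "Y \<inter> M = C" using cover_between[OF XY(2)] i M YM by blast
  define D where "D = S \<inter> M"
  have iD: "lideal D"
    unfolding D_def by (rule lideal_Int_maxsub[OF M(1) iS MX]) (use brXS M(2) in blast)
  have sD: "subspace D" using iD by (rule lideal_subspace)
  have DX: "D \<inter> X = C" and DY: "D \<inter> Y = C" using XM YM' XS YS by (auto simp: D_def)
  \<comment> \<open>Modular law, with \<open>Z \<subseteq> S\<close>: intersecting M + Z = L with
    \<open>S\<close> gives (S \<inter> M) + Z.\<close>
  have D_plus: "qadd D Z = S" if Z: "subspace Z" "Z \<subseteq> S" "qadd M Z = UNIV" for Z
  proof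
    show "qadd D Z \<subseteq> S" using Z s by (intro qadd_least) (auto simp: D_def)
    show "S \<subseteq> qadd D Z"
    proof
      fix u assume u: "u \<in> S"
      obtain m z where mz: "m \<in> M" "z \<in> Z" "u = m + z" using Z(3) mem_qadd[of u M Z] by auto
      then have "m = u - z" by simp
      then have "m \<in> S" using u mz Z s by (metis subsetD subspace_diff)
      then show "u \<in> qadd D Z" using mz by (auto simp: mem_qadd D_def)
    qed
  qed
  have DXS: "qadd D X = S" and DYS: "qadd D Y = S" using D_plus s XS YS MX MY by auto
  have "Lmod_iso scale br X C S D" "Lmod_iso scale br Y C S D"
    using second_isomorphism[OF iD i(1)] second_isomorphism[OF iD i(2)]
    by (simp_all add: DX DY DXS DYS)
  then have iso: "Lmod_iso scale br X C Y C" using Lmod_iso_trans Lmod_iso_sym i by metis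
  have nFY: "\<not> frat Y C" using M YM unfolding frat_def by blast
  \<comment> \<open>Y/C is abelian because \<open>Y\<close> lies in D + X and brackets of
    \<open>Y\<close> with \<open>D\<close> and with \<open>X\<close> both end in
    \<open>C\<close>.\<close>
  have brYY: "br y z \<in> C" if yz: "y \<in> Y" "z \<in> Y" for y z
  proof -
    have "z \<in> qadd D X" using yz YS DXS by auto
    then obtain d x where dx: "d \<in> D" "x \<in> X" "z = d + x" unfolding mem_qadd by auto
    have "br y d \<in> C" using dx that lideal_br_right[OF iD] lideal_br_left[OF i(2)] DY by blast
    moreover have "br y x \<in> C" using dx that brXY by blast
    ultimately show ?thesis using s by (simp add: dx br_add_right subspace_add)
  qed
  have "frat S X"
  proof (rule ccontr)
    assume "\<not> frat S X"
    then obtain M' where M': "maxsub M'" "X \<subseteq> M'" "\<not> S \<subseteq> M'" unfolding frat_def by blast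
    have sM': "subspace M'" using M' by (simp add: subM)
    have YM1: "\<not> Y \<subseteq> M'" using qadd_least[OF sM' M'(2)] M'(3) by (auto simp: S_def)
    have DM1: "\<not> D \<subseteq> M'" using qadd_least[OF sM' _ M'(2)] M'(3) DXS by auto
    have M'D: "qadd M' D = UNIV" and M'Y: "qadd M' Y = UNIV"
      using maxsub_qadd_ideal M' DM1 YM1 i iD by blast+
    have "lideal (Y \<inter> M')"
      by (rule lideal_Int_maxsub[OF M'(1) i(2) M'Y]) (use brYY i M'(2) in blast)
    then have YM2: "Y \<inter> M' = C" using cover_between[OF XY(2)] i M' YM1 by blast
    have DM': "d \<in> C" if d: "d \<in> D" "d \<in> M'" for d
    proof -
      obtain x y where xy: "x \<in> X" "y \<in> Y" "d = x + y" using d by (auto simp: D_def S_def mem_qadd)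
      then have "y = d - x" by simp
      then have "y \<in> M'" using xy d M'(2) sM' by (metis subsetD subspace_diff)
      then have "y \<in> X" using YM2 xy i by blast
      then have "d \<in> X" using xy s by (simp add: subspace_add)
      then show ?thesis using d DX by blast
    qed
    \<comment> \<open>\<open>T\<close> contains \<open>Y\<close>, so every maximal \<open>Q\<close>
      above it contains \<open>S\<close>. But L = M + X and each \<open>m\<close> in
      \<open>M\<close> splits along M' + D with both parts in \<open>M\<close>, so L = (M \<inter>
      M') + D + X \<subseteq> Q.\<close>
    define T where "T = qadd (M \<inter> M') Y"
    have sN: "subspace (M \<inter> M')" using sM sM' by (rule subspace_inter)
    have "subalg (M \<inter> M')" using M M' sN by (simp add: subM)
    then have T: "subalg T" unfolding T_def using i by (intro subalg_qadd)
    have YT: "Y \<subseteq> T" and NT: "M \<inter> M' \<subseteq> T"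
      using qadd_upper1[OF s(2)] qadd_upper2[OF sN] unfolding T_def by blast+
    have TU: "T \<noteq> UNIV"
    proof
      assume TU: "T = UNIV"
      \<comment> \<open>In x = n + y the part \<open>n\<close> lies in D \<inter> M' \<subseteq> C,
        which puts \<open>y\<close> into X \<inter> Y = C.\<close>
      have "x \<in> C" if x: "x \<in> X" for x
      proof -
        obtain n y where ny: "n \<in> M" "n \<in> M'" "y \<in> Y" "x = n + y"
          using TU unfolding T_def by (metis IntE UNIV_I mem_qadd)
        then have e: "n = x - y" "y = x - n" by simp_all
        have "n \<in> S" using e(1) x ny XS YS s by (metis subsetD subspace_diff)
        then have "n \<in> C" using ny DM' by (simp add: D_def)
        then have "y \<in> X" using e(2) x i s by (metis subsetD subspace_diff)
        then have "y \<in> C" using ny C by blast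
        then show ?thesis using \<open>n \<in> C\<close> ny s by (simp add: subspace_add)
      qed
      then show False using i by blast
    qed
    obtain Q where Q: "maxsub Q" "T \<subseteq> Q" using maxsub_exists[OF T TU] by metis
    have sQ: "subspace Q" using Q by (simp add: subM)
    have SQ: "S \<subseteq> Q" using F Q YT unfolding frat_def S_def by blast
    have "l \<in> Q" for l
    proof -
      obtain m x where mx: "m \<in> M" "x \<in> X" "l = m + x" using MX mem_qadd[of l M X] by auto
      obtain n d where nd: "n \<in> M'" "d \<in> D" "m = n + d" using M'D mem_qadd[of m M' D] by auto
      have "m - d \<in> M" using mx nd sM unfolding D_def by (intro subspace_diff) auto
      then have "n \<in> M" by (simp add: nd(3))
      then have "n \<in> Q" using nd NT Q by blast
      moreover have "d \<in> Q" "x \<in> Q" using nd mx SQ XS by (auto simp: D_def)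
      ultimately show ?thesis using sQ by (simp add: mx nd subspace_add)
    qed
    then show False using Q by (auto simp: subM)
  qed
  then show ?thesis using iso nFY by (simp add: S_def)
qed

text \<open>A pair \<open>(A, B)\<close> stands for A/B; both ideals are kept because
  \<open>frat\<close> refers to their position in L.\<close>

definition factor_equiv :: "'v set \<times> 'v set \<Rightarrow> 'v set \<times> 'v set \<Rightarrow> bool" where
  "factor_equiv p q \<longleftrightarrow> Lmod_iso scale br (fst p) (snd p) (fst q) (snd q) \<and>
    (frat (fst p) (snd p) \<longleftrightarrow> frat (fst q) (snd q))"

lemma factor_equiv_refl: "factor_equiv p p"
  by (simp add: factor_equiv_def Lmod_iso_refl)

lemma rel_mset_factor_equiv_refl: "rel_mset factor_equiv N N"
  by (rule multiset.rel_refl) (rule factor_equiv_refl)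

lemma rel_mset_factor_equiv_trans:
  assumes "rel_mset factor_equiv L M" "rel_mset factor_equiv M N"
  shows "rel_mset factor_equiv L N"
proof -
  have "rel_mset (factor_equiv OO factor_equiv) L N"
    using assms by (auto simp: multiset.rel_compp)
  moreover have "factor_equiv OO factor_equiv \<le> factor_equiv"
    by (auto simp: factor_equiv_def intro: Lmod_iso_trans)
  ultimately show ?thesis using multiset.rel_mono by blast
qed

lemma factor_equiv_diamond:
  assumes XY: "cover C X" "cover C Y" "X \<noteq> Y"
  defines "S \<equiv> qadd X Y"
  shows "rel_mset factor_equiv {#(X, C), (S, X)#} {#(Y, C), (S, Y)#}"
proof -
  have C: "X \<inter> Y = C" using cover_Int[OF XY] .
  have i: "lideal X" "lideal Y" "lideal C" using XY by (auto simp: cover_def)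
  have S: "S = qadd Y X" by (simp add: S_def qadd_commute)
  have XS: "Lmod_iso scale br X C S Y" and YS: "Lmod_iso scale br Y C S X"
    using Lmod_iso_diamond[OF i(1,2)] second_isomorphism[OF i(1,2)] by (simp_all add: C S_def)
  note SX = Lmod_iso_sym[OF i(2,3) YS]
  note mono = frat_mono[OF XY(1,2), folded S_def] frat_mono[OF XY(2,1), folded S]
  \<comment> \<open>Monotonicity leaves two situations: the diagonals agree and are paired, or a
    diagonal has its Frattini factor on top only, and the exchange pairs bottom with bottom and top
    with top.\<close>
  consider "frat X C = frat S Y" "frat Y C = frat S X"
    | "\<not> frat X C" "frat S Y" | "\<not> frat Y C" "frat S X"
    using mono by blast
  then show ?thesis
  proof cases
    case 1
    then have "factor_equiv (X, C) (S, Y)" "factor_equiv (S, X) (Y, C)"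
      using XS SX by (simp_all add: factor_equiv_def)
    then have "rel_mset factor_equiv {#(X, C), (S, X)#} {#(S, Y), (Y, C)#}"
      by (intro rel_mset_Plus rel_mset_Zero)
    then show ?thesis by (simp add: add_mset_commute)
  next
    case 2
    then have "Lmod_iso scale br X C Y C \<and> \<not> frat Y C \<and> frat S X"
      using frat_exchange[OF XY] by (simp add: S_def)
    then have "factor_equiv (X, C) (Y, C)" "factor_equiv (S, X) (S, Y)"
      using 2 Lmod_iso_trans[OF SX Lmod_iso_trans[OF _ XS]] Lmod_iso_sym[OF i(1,3)]
      by (auto simp: factor_equiv_def)
    then show ?thesis by (intro rel_mset_Plus rel_mset_Zero)
  next
    case 3
    then have "Lmod_iso scale br Y C X C \<and> \<not> frat X C \<and> frat S Y"
      using frat_exchange[OF XY(2,1)] XY(3) by (simp add: S)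
    then have "factor_equiv (X, C) (Y, C)" "factor_equiv (S, X) (S, Y)"
      using 3 Lmod_iso_trans[OF SX Lmod_iso_trans[OF _ XS]] Lmod_iso_sym[OF i(2,3)]
      by (auto simp: factor_equiv_def)
    then show ?thesis by (intro rel_mset_Plus rel_mset_Zero)
  qed
qed

subsection \<open>The Jordan-Hoelder theorem\<close>

text \<open>The free bottom \<open>C\<close> takes over the role of passing to L/C. A multiset
  suffices since the matching ignores the order of the factors.\<close>

inductive series :: "'v set \<Rightarrow> ('v set \<times> 'v set) multiset \<Rightarrow> bool" where
  series_UNIV: "series UNIV {#}"
| series_step: "cover C X \<Longrightarrow> series X N \<Longrightarrow> series C (add_mset (X, C) N)"

text \<open>A maximal counterexample \<open>M\<close> would have a cover, whose series extends to
  \<open>M\<close>.\<close>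

lemma series_exists:
  assumes "lideal C"
  shows "\<exists>N. series C N"
proof (rule ccontr)
  let ?P = "\<lambda>C. lideal C \<and> (\<nexists>N. series C N)"
  assume "\<nexists>N. series C N"
  with assms have "?P C" by simp
  then have "\<exists>M. ?P M \<and> C \<subseteq> M \<and> (\<forall>T. ?P T \<longrightarrow> M \<subseteq> T \<longrightarrow> T = M)"
    by (rule maximal_subspace) (auto simp: lideal_iff)
  then obtain M where M: "?P M" "\<And>T. ?P T \<Longrightarrow> M \<subseteq> T \<Longrightarrow> T = M" by metis
  then have "M \<noteq> UNIV" using series_UNIV by auto
  then obtain X where X: "cover M X" using cover_exists M by metis
  then have "lideal X" "M \<subseteq> X" "X \<noteq> M" by (auto simp: cover_def)
  then obtain N where "series X N" using M(2)[of X] by auto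
  then show False using series_step[OF X] M(1) by auto
qed

lemma jordan_hoelder:
  assumes "series C N" "series C N'"
  shows "rel_mset factor_equiv N N'"
  using assms
proof (induction "size N" arbitrary: C N N' rule: less_induct)
  case less
  have nc: "\<not> cover UNIV X" for X by (auto simp: cover_def)
  from less.prems(1) show ?case
  proof cases
    case series_UNIV
    then have "N' = {#}" using less.prems(2) nc by (auto elim: series.cases)
    then show ?thesis using series_UNIV by simp
  next
    case (series_step X N1)
    then have "C \<noteq> UNIV" using nc by blast
    from less.prems(2) obtain Y N2 where Y: "N' = add_mset (Y, C) N2" "cover C Y" "series Y N2"
      using \<open>C \<noteq> UNIV\<close> by cases auto
    have IH: "rel_mset factor_equiv L L'" if "size L = size N1" "series Z L" "series Z L'" for L Z L'
      using less.hyps[of L Z L'] that series_step by simp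
    show ?thesis
    proof (cases "X = Y")
      case True
      then show ?thesis using IH[of N1 X N2] Y series_step
        by (auto intro: rel_mset_Plus factor_equiv_refl)
    next
      case False
      define S where "S = qadd X Y"
      have S: "cover X S" "cover Y S"
        using cover_qadd[OF series_step(2) Y(2) False]
          cover_qadd[OF Y(2) series_step(2) False[symmetric]]
        unfolding S_def by (simp_all only: qadd_commute[of Y X])
      then have "lideal S" by (simp add: cover_def)
      then obtain N0 where N0: "series S N0" using series_exists by blast
      have XN: "series X (add_mset (S, X) N0)" and YN: "series Y (add_mset (S, Y) N0)"
        using series.series_step S N0 by auto
      have 1: "rel_mset factor_equiv N1 (add_mset (S, X) N0)"
        using IH[OF _ series_step(3) XN] by simp
      \<comment> \<open>The length of \<open>N2\<close> is not known yet, so the induction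
        hypothesis is applied to the series from \<open>Y\<close> through \<open>S\<close>, whose
        length is fixed by the matching just found.\<close>
      then have "size (add_mset (S, Y) N0) = size N1" using rel_mset_size by fastforce
      then have 2: "rel_mset factor_equiv (add_mset (S, Y) N0) N2" using IH YN Y(3) by blast
      have "rel_mset factor_equiv ({#(X, C), (S, X)#} + N0) ({#(Y, C), (S, Y)#} + N0)"
        using factor_equiv_diamond[OF series_step(2) Y(2) False]
        unfolding S_def by (rule rel_mset_union) (rule rel_mset_factor_equiv_refl)
      then have "rel_mset factor_equiv (add_mset (X, C) (add_mset (S, X) N0))
          (add_mset (Y, C) (add_mset (S, Y) N0))" by simp
      moreover note rel_mset_Plus[OF factor_equiv_refl 1, of "(X, C)"]
        rel_mset_Plus[OF factor_equiv_refl 2, of "(Y, C)"]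
      ultimately show ?thesis
        unfolding series_step(1) Y(1) by (metis rel_mset_factor_equiv_trans)
    qed
  qed
qed

lemma series_of_chief_series:
  assumes "chief_series scale br A n"
  shows "series {0} (image_mset (\<lambda>i. (A i, A (i - 1))) (mset_set {1..n}))"
proof -
  \<comment> \<open>The induction runs downwards from \<open>n\<close>, because
    \<open>series\<close> grows at its bottom.\<close>
  have "series (A i) (image_mset (\<lambda>i. (A i, A (i - 1))) (mset_set {Suc i..n}))" if "i \<le> n" for i
    using that
  proof (induction rule: inc_induct)
    case base
    then show ?case using assms series_UNIV by (simp add: chief_series_def)
  next
    case (step i)
    have "cover (A i) (A (Suc i))" using assms step(1,2) unfolding cover_def chief_series_def by auto
    moreover have "{Suc i..n} = insert (Suc i) {Suc (Suc i)..n}" using step by auto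
    ultimately show ?case using series_step step.IH by simp
  qed
  from this[of 0] show ?thesis using assms by (simp add: chief_series_def)
qed

end

section \<open>From matched factors to a permutation of the indices\<close>

theorem theorem2p4:
  fixes scale :: "'a::field \<Rightarrow> 'v::ab_group_add \<Rightarrow> 'v"
    and br :: "'v \<Rightarrow> 'v \<Rightarrow> 'v"
    and A B :: "nat \<Rightarrow> 'v set" and n :: nat
  assumes "lie_algebra scale br" and "finite_dim scale"
    and "chief_series scale br A n" and "chief_series scale br B n"
  shows "\<exists>\<sigma>. bij_betw \<sigma> {1..n} {1..n} \<and>
           (\<forall>i\<in>{1..n}.
              Lmod_iso scale br (A i) (A (i - 1)) (B (\<sigma> i)) (B (\<sigma> i - 1)) \<and>
              (frattini_factor scale br (A i) (A (i - 1)) \<longleftrightarrow>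
               frattini_factor scale br (B (\<sigma> i)) (B (\<sigma> i - 1))))"
proof -
  interpret V: vector_space scale using assms(1) by (simp add: lie_algebra_def)
  obtain S where S: "finite S" "V.span S = UNIV" using assms(2) by (auto simp: finite_dim_def)
  obtain Basis where Basis: "Basis \<subseteq> S" "V.independent Basis" "S \<subseteq> V.span Basis"
    using V.maximal_independent_subset by metis
  then have "V.span Basis = UNIV" using S(2) V.span_minimal[OF Basis(3)] by auto
  interpret fin_lie scale Basis br
  proof
    show "finite Basis" using Basis S finite_subset by metis
    show "V.independent Basis" "V.span Basis = UNIV" by fact+
  qed (use assms(1) in \<open>auto simp: lie_algebra_def\<close>)
  have frat_iff: "frattini_factor scale br (E i) (E (i - 1)) \<longleftrightarrow> frat (E i) (E (i - 1))"
    if "chief_series scale br E n" "i \<in> {1..n}" for E i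
  proof -
    have "i - 1 < n" "Suc (i - 1) = i" using that(2) by auto
    then have "lideal (E (i - 1))" "lideal (E i)" "E (i - 1) \<subset> E i"
      using that unfolding chief_series_def by (metis less_imp_le, metis Suc_leI, metis)
    then show ?thesis by (intro frattini_factor_iff) auto
  qed
  have "rel_mset factor_equiv (image_mset (\<lambda>i. (A i, A (i - 1))) (mset_set {1..n}))
      (image_mset (\<lambda>i. (B i, B (i - 1))) (mset_set {1..n}))"
    by (rule jordan_hoelder[OF series_of_chief_series series_of_chief_series]) (rule assms)+
  \<comment> \<open>Matching indices instead of pairs gives the form that
    \<open>rel_mset_set_bij\<close> turns into a bijection.\<close>
  then have "rel_mset (\<lambda>i j. factor_equiv (A i, A (i - 1)) (B j, B (j - 1)))
      (mset_set {1..n}) (mset_set {1..n})"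
    by (simp add: multiset.rel_map)
  from rel_mset_set_bij[OF this] obtain \<sigma> where \<sigma>: "bij_betw \<sigma> {1..n} {1..n}"
    "\<And>i. i \<in> {1..n} \<Longrightarrow> factor_equiv (A i, A (i - 1)) (B (\<sigma> i), B (\<sigma> i - 1))"
    by auto
  have "\<sigma> i \<in> {1..n}" if "i \<in> {1..n}" for i using \<sigma>(1) that by (auto simp: bij_betw_def)
  then show ?thesis
    using \<sigma> frat_iff[OF assms(3)] frat_iff[OF assms(4)]
    by (intro exI[of _ \<sigma>]) (simp add: factor_equiv_def)
qed

end
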